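(* Let $\Lambda\subset\mathbb{N}_0^d$ be an arbitrary finite index set. A rank-1 lattice rule $Q_n^*$ with $n$ points and generating vector $\boldsymbol{z}\in\mathbb{Z}^d$ reconstructs exactly the cosine coefficients of all cosine space functions $f\in\mathcal{F}^{\cos}_\Lambda$ solely supported on $\Lambda$, by $$\widehat f_{\boldsymbol{k}}=\widehat f^{\,b}_{\boldsymbol{k}}:=Q_n^*\big((f\circ\varphi_{\rm tent})\,\sqrt2^{\,|\boldsymbol{k}|_0}\cos(2\pi\boldsymbol{k}\cdot\,\bullet\,)\big)\qquad\text{for all }\boldsymbol{k}\in\Lambda,$$ if and only if $$\boldsymbol{\sigma}(\boldsymbol{k}')\cdot\boldsymbol{z}\not\equiv\boldsymbol{k}\cdot\boldsymbol{z}\pmod n\qquad\text{for all }\boldsymbol{k},\boldsymbol{k}'\in\Lambda,\ \boldsymbol{\sigma}\in\mathcal{S}_{\boldsymbol{k}'},\ \boldsymbol{\sigma}(\boldsymbol{k}')\ne\boldsymbol{k},$$ which is equivalent to $$\boldsymbol{h}\cdot\boldsymbol{z}\not\equiv0\pmod n\qquad\text{for all }\boldsymbol{h}\in(\Lambda\oplus\mathcal{M}(\Lambda))\setminus\{\boldsymbol{0}\}.$$ Such a generating vector $\boldsymbol{z}$ can be constructed component-by-component if $n$ is a prime satisfying $$n>\max\{\#(\Lambda\oplus\mathcal{M}(\Lambda)),\ 2\max(\Lambda)\}.$$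
   Context: Cosine basis: $\phi_{\boldsymbol{k}}(\boldsymbol{x})=\sqrt2^{\,|\boldsymbol{k}|_0}\prod_{j=1}^d\cos(\pi k_jx_j)$ on $[0,1]^d$, $\boldsymbol{k}\in\mathbb{N}_0^d$, with $|\boldsymbol{k}|_0$ the number of nonzero components. $\mathcal{F}^{\cos}_\Lambda$ is the set of real-valued functions $f=\sum_{\boldsymbol{k}\in\Lambda}\widehat f_{\boldsymbol{k}}\,\phi_{\boldsymbol{k}}$ on $[0,1]^d$; the cosine coefficients are $\widehat f_{\boldsymbol{k}}=\int_{[0,1]^d}f\,\phi_{\boldsymbol{k}}\,d\boldsymbol{x}$. The rank-1 lattice rule is $Q_n^*(g)=\frac1n\sum_{i=0}^{n-1}g\big(\frac{i\boldsymbol{z}\bmod n}{n}\big)$ (mod applied componentwise); $\varphi_{\rm tent}(x)=1-|2x-1|$ is applied componentwise; $\cos(2\pi\boldsymbol{k}\cdot\bullet)$ denotes the function $\boldsymbol{x}\mapsto\cos(2\pi\boldsymbol{k}\cdot\boldsymbol{x})$. $\boldsymbol{\sigma}(\boldsymbol{k})=(\sigma_1k_1,\ldots,\sigma_dk_d)$; $\mathcal{S}_{\boldsymbol{k}}=\{\boldsymbol{\sigma}\in\{\pm1\}^d:\sigma_j=+1\text{ if }k_j=0\}$; $\mathcal{M}(\Lambda)=\{\boldsymbol{\sigma}(\boldsymbol{k}):\boldsymbol{k}\in\Lambda,\boldsymbol{\sigma}\in\{\pm1\}^d\}$; $A\oplus B=\{\boldsymbol{a}+\boldsymbol{b}:\boldsymbol{a}\in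 A,\boldsymbol{b}\in B\}$; $\max(\Lambda)=\max_{\boldsymbol{k}\in\Lambda}\max_j|k_j|$; $\#$ is cardinality. "Constructed component-by-component": for an index set $\mathcal{A}\subset\mathbb{Z}^d$ (here $\mathcal{A}=\Lambda\oplus\mathcal{M}(\Lambda)$) and its projections $\mathcal{A}_s$, $s=1,\ldots,d$, given either by $\mathcal{A}_s=\{\boldsymbol{h}\in\mathbb{Z}^s:(\boldsymbol{h},\boldsymbol{0})\in\mathcal{A}\}$ or by $\mathcal{A}_s=\{\boldsymbol{h}\in\mathbb{Z}^s:(\boldsymbol{h},\boldsymbol{h}_\perp)\in\mathcal{A}\text{ for some }\boldsymbol{h}_\perp\}$, the components $z_1,\ldots,z_d\in\{1,\ldots,n-1\}$ can be chosen one at a time: whenever $z_1,\ldots,z_{s-1}$ satisfy $\boldsymbol{h}\cdot(z_1,\ldots,z_{s-1})\not\equiv0\pmod n$ for all $\boldsymbol{h}\in\mathcal{A}_{s-1}\setminus\{\boldsymbol{0}\}$ (no condition if $s=1$), there exists $z_s\in\{1,\ldots,n-1\}$ with $\boldsymbol{h}\cdot(z_1,\ldots,z_s)\not\equiv0\pmod n$ for all $\boldsymbol{h}\in\mathcal{A}_s\setminus\{\boldsymbol{0}\}$. Since $\mathcal{A}_d=\mathcal{A}$, the resulting $\boldsymbol{z}$ satisfies the required condition. *)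

theory Defs
  imports
    "HOL-Analysis.Lebesgue_Measure"
    "HOL-Analysis.Set_Integral"
    "HOL-Library.Set_Algebras"
    "HOL-Number_Theory.Cong"
    "Jordan_Normal_Form.Matrix"
begin

text \<open>Elements of \<open>\<int>\<^sup>d\<close> and points of \<open>\<real>\<^sup>d\<close> are vectors in \<open>carrier_vec d\<close>, with components numbered from
  \<open>0\<close> to \<open>d - 1\<close>. \<open>\<nat>\<^sub>0\<^sup>d\<close> is regarded as a subset of \<open>\<int>\<^sup>d\<close>.\<close>

unbundle no inner_syntax and no vec_syntax

definition nonneg_vecs :: "nat \<Rightarrow> int vec set" where
  "nonneg_vecs d = {k \<in> carrier_vec d. \<forall>j<d. 0 \<le> k $ j}"

definition unit_cube :: "nat \<Rightarrow> real vec set" where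
  "unit_cube d = {x \<in> carrier_vec d. \<forall>j<d. x $ j \<in> {0..1}}"


subsection \<open>Cosine series\<close>

definition l0 :: "int vec \<Rightarrow> nat" where
  "l0 k = card {j. j < dim_vec k \<and> k $ j \<noteq> 0}"

definition cos_basis :: "int vec \<Rightarrow> real vec \<Rightarrow> real" where
  "cos_basis k x = sqrt 2 ^ l0 k * (\<Prod>j<dim_vec k. cos (pi * of_int (k $ j) * x $ j))"

text \<open>The product measure lives on extensional functions \<open>nat \<Rightarrow> real\<close>; \<open>vec d\<close> turns such a function
  into a vector.\<close>

definition cube_integral :: "nat \<Rightarrow> (real vec \<Rightarrow> real) \<Rightarrow> real" where
  "cube_integral d g =
     (LINT x:({..<d} \<rightarrow>\<^sub>E {0..1})|(Pi\<^sub>M {..<d} (\<lambda>_. lborel)). g (vec d x))"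

definition cos_coeff :: "(real vec \<Rightarrow> real) \<Rightarrow> int vec \<Rightarrow> real" where
  "cos_coeff f k = cube_integral (dim_vec k) (\<lambda>x. f x * cos_basis k x)"

text \<open>Functions are total in HOL, so membership only constrains the values on the unit cube.\<close>

definition cos_space :: "nat \<Rightarrow> int vec set \<Rightarrow> (real vec \<Rightarrow> real) set" where
  "cos_space d \<Lambda> =
     {f. \<forall>x \<in> unit_cube d. f x = (\<Sum>k\<in>\<Lambda>. cos_coeff f k * cos_basis k x)}"


subsection \<open>Lattice rules and the tent transform\<close>

definition lattice_point :: "nat \<Rightarrow> int vec \<Rightarrow> nat \<Rightarrow> real vec" where
  "lattice_point n z i = map_vec (\<lambda>c. of_int ((int i * c) mod int n) / of_nat n) z"

definition lattice_rule :: "nat \<Rightarrow> int vec \<Rightarrow> (real vec \<Rightarrow> real) \<Rightarrow> real" where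
  "lattice_rule n z g = (\<Sum>i<n. g (lattice_point n z i)) / of_nat n"

definition tent :: "real \<Rightarrow> real" where
  "tent x = 1 - \<bar>2 * x - 1\<bar>"

definition lattice_cos_coeff :: "nat \<Rightarrow> int vec \<Rightarrow> (real vec \<Rightarrow> real) \<Rightarrow> int vec \<Rightarrow> real" where
  "lattice_cos_coeff n z f k =
     lattice_rule n z
       (\<lambda>x. f (map_vec tent x) * (sqrt 2 ^ l0 k * cos (2 * pi * (map_vec of_int k \<bullet> x))))"

definition reconstructs :: "nat \<Rightarrow> nat \<Rightarrow> int vec \<Rightarrow> int vec set \<Rightarrow> bool" where
  "reconstructs d n z \<Lambda> \<longleftrightarrow>
     (\<forall>f \<in> cos_space d \<Lambda>. \<forall>k \<in> \<Lambda>. cos_coeff f k = lattice_cos_coeff n z f k)"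


subsection \<open>Sign changes and index sets\<close>

definition signs :: "nat \<Rightarrow> int vec set" where
  "signs d = {\<sigma> \<in> carrier_vec d. \<forall>j<d. \<sigma> $ j \<in> {1, -1}}"

definition signs_of :: "int vec \<Rightarrow> int vec set" where
  "signs_of k = {\<sigma> \<in> signs (dim_vec k). \<forall>j<dim_vec k. k $ j = 0 \<longrightarrow> \<sigma> $ j = 1}"

definition sign_change :: "int vec \<Rightarrow> int vec \<Rightarrow> int vec" where
  "sign_change \<sigma> k = vec (dim_vec k) (\<lambda>j. \<sigma> $ j * k $ j)"

definition mirror :: "int vec set \<Rightarrow> int vec set" where
  "mirror \<Lambda> = {sign_change \<sigma> k | \<sigma> k. k \<in> \<Lambda> \<and> \<sigma> \<in> signs (dim_vec k)}"

text \<open>The inserted \<open>0\<close> only matters for empty \<open>\<Lambda>\<close>, where it fixes the maximum to be \<open>0\<close>.\<close>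

definition max_component :: "int vec set \<Rightarrow> int" where
  "max_component \<Lambda> = Max (insert 0 {\<bar>k $ j\<bar> | k j. k \<in> \<Lambda> \<and> j < dim_vec k})"


subsection \<open>Component-by-component construction\<close>

definition nonvanishing_mod :: "nat \<Rightarrow> int vec set \<Rightarrow> int vec \<Rightarrow> bool" where
  "nonvanishing_mod n A z \<longleftrightarrow> (\<forall>h \<in> A - {0\<^sub>v (dim_vec z)}. \<not> [h \<bullet> z = 0] (mod int n))"

definition zero_sections :: "nat \<Rightarrow> int vec set \<Rightarrow> nat \<Rightarrow> int vec set" where
  "zero_sections d A s = {h \<in> carrier_vec s. h @\<^sub>v 0\<^sub>v (d - s) \<in> A}"

definition projections :: "nat \<Rightarrow> int vec set \<Rightarrow> nat \<Rightarrow> int vec set" where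
  "projections d A s = {h \<in> carrier_vec s. \<exists>g \<in> carrier_vec (d - s). h @\<^sub>v g \<in> A}"

definition gen_vecs :: "nat \<Rightarrow> nat \<Rightarrow> int vec set" where
  "gen_vecs n s = {z \<in> carrier_vec s. \<forall>j<s. z $ j \<in> {1..int n - 1}}"

text \<open>In the step from \<open>s\<close> to \<open>s + 1\<close> components, the case \<open>s = 0\<close> imposes no condition on the empty
  vector \<open>z\<close>, because the only vector of dimension \<open>0\<close> is \<open>0\<^sub>v 0\<close>.\<close>

definition cbc_constructible ::
  "nat \<Rightarrow> nat \<Rightarrow> int vec set \<Rightarrow> (nat \<Rightarrow> int vec set) \<Rightarrow> bool" where
  "cbc_constructible d n A P \<longleftrightarrow>
     P d = A \<and>
     (\<forall>s<d. \<forall>z \<in> gen_vecs n s. nonvanishing_mod n (P s) z \<longrightarrow>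
        (\<exists>c \<in> {1..int n - 1}. nonvanishing_mod n (P (Suc s)) (z @\<^sub>v vec 1 (\<lambda>_. c))))"

end

theory Submission
  imports Defs "HOL-Analysis.Equivalence_Lebesgue_Henstock_Integration"
begin

unbundle no inner_syntax and no vec_syntax

text \<open>The tent transform turns the half-period cosines into full-period ones on the unit interval,
  \<open>cos (\<pi> k (tent x)) = cos (2 \<pi> k x)\<close>. By Euler's formula the product over the coordinates is
  then an average of exponentials, one for each sign vector in \<open>signs_of k\<close>. A rank-1 lattice rule
  integrates the exponential of frequency \<open>h\<close> to \<open>1\<close> if \<open>n\<close> divides \<open>h \<bullet> z\<close> and to \<open>0\<close> otherwise. Hence the
  approximate coefficient of the basis function \<open>k'\<close> at \<open>k\<close> is a positive multiple of the number
  of sign changes of \<open>k'\<close> that alias with \<open>k\<close> (lemma \<open>lattice_cos_coeff_cos_basis\<close>), and that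
  multiple is \<open>1\<close> for \<open>k = k'\<close>.

  Both the exact and the approximate coefficients are linear, and the cosine basis is orthonormal,
  so reconstruction on the whole space means that each of these numbers is the Kronecker delta
  (\<open>reconstructs_iff_basis\<close>). Since indices are nonnegative, a sign change of \<open>k'\<close> equals \<open>k\<close>
  only if \<open>k = k'\<close> and all signs are \<open>+1\<close>; this coincidence supplies the \<open>1\<close> on the diagonal, and
  every other alias must be absent (\<open>lattice_cos_coeff_eq_delta_iff\<close>). The sumset form of the
  condition only moves one index to the other side, absorbing the minus sign into the sign vector.

  For the construction, suppose that every candidate \<open>c\<close> for the next component is spoiled by some
  nonzero \<open>h\<close> of the index set. The last entry of such an \<open>h\<close> is nonzero by the choice
  of the previous components, and smaller than \<open>n\<close> in absolute value, so it is invertible modulo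
  the prime \<open>n\<close> and \<open>h\<close> spoils only one \<open>c\<close>. Thus the \<open>n - 1\<close> candidates inject into the nonzero
  elements of a set with fewer than \<open>n\<close> elements, zero included, which is impossible
  (\<open>next_component_exists\<close>).\<close>

section \<open>Sign vectors\<close>

text \<open>The sign vectors of \<open>k\<close> are a product set: coordinatewise choices, free only where \<open>k\<close> is
  nonzero. This is what lets a sum over them factor into a product over coordinates.\<close>

lemma bij_betw_PiE_signs_of:
  "bij_betw (vec (dim_vec k))
     (PiE {..<dim_vec k} (\<lambda>j. if k $ j = 0 then {1} else {1, -1})) (signs_of k)"
proof (rule bij_betw_byWitness[where f' = "\<lambda>\<sigma>. restrict (\<lambda>j. \<sigma> $ j) {..<dim_vec k}"])
  show "\<forall>g\<in>PiE {..<dim_vec k} (\<lambda>j. if k $ j = 0 then {1::int} else {1, -1}).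
          restrict (\<lambda>j. vec (dim_vec k) g $ j) {..<dim_vec k} = g"
    by (force simp: PiE_def extensional_def restrict_def)
  show "\<forall>\<sigma>\<in>signs_of k. vec (dim_vec k) (restrict (\<lambda>j. \<sigma> $ j) {..<dim_vec k}) = \<sigma>"
    by (auto simp: signs_of_def signs_def intro!: eq_vecI)
  show "vec (dim_vec k) ` PiE {..<dim_vec k} (\<lambda>j. if k $ j = 0 then {1} else {1, -1}) \<subseteq> signs_of k"
    by (fastforce simp: signs_of_def signs_def PiE_iff split: if_splits)
  show "(\<lambda>\<sigma>. restrict (\<lambda>j. \<sigma> $ j) {..<dim_vec k}) ` signs_of k
          \<subseteq> PiE {..<dim_vec k} (\<lambda>j. if k $ j = 0 then {1} else {1, -1})"
    by (auto simp: signs_of_def signs_def split: if_splits)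
qed

lemma finite_signs_of [simp]: "finite (signs_of k)"
  using bij_betw_finite[OF bij_betw_PiE_signs_of[of k]] by (auto intro!: finite_PiE)

lemma finite_signs: "finite (signs d)"
proof -
  have "signs d = signs_of (vec d (\<lambda>_. 1))" by (auto simp: signs_of_def)
  thus ?thesis by simp
qed

lemma sign_change_carrier [simp]: "k \<in> carrier_vec d \<Longrightarrow> sign_change \<sigma> k \<in> carrier_vec d"
  by (simp add: sign_change_def)

lemma dim_sign_change [simp]: "dim_vec (sign_change \<sigma> k) = dim_vec k"
  by (simp add: sign_change_def)

lemma one_in_signs_of: "vec (dim_vec k) (\<lambda>_. 1) \<in> signs_of k"
  by (auto simp: signs_of_def signs_def)

lemma sign_change_one [simp]: "sign_change (vec (dim_vec k) (\<lambda>_. 1)) k = k"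
  by (auto simp: sign_change_def)

text \<open>Fixing the sign \<open>+1\<close> where \<open>k\<close> vanishes removes the only ambiguity, so aliases can be counted by
  sign vectors instead of by frequencies.\<close>

lemma inj_on_sign_change: "inj_on (\<lambda>\<sigma>. sign_change \<sigma> k) (signs_of k)"
proof (rule inj_onI)
  fix \<sigma> \<tau> assume *: "\<sigma> \<in> signs_of k" "\<tau> \<in> signs_of k" "sign_change \<sigma> k = sign_change \<tau> k"
  show "\<sigma> = \<tau>"
  proof (rule eq_vecI)
    show "dim_vec \<sigma> = dim_vec \<tau>" using * by (auto simp: signs_of_def signs_def)
    fix j assume "j < dim_vec \<tau>"
    hence j: "j < dim_vec k" using * by (auto simp: signs_of_def signs_def)
    have "sign_change \<sigma> k $ j = sign_change \<tau> k $ j" using * by simp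
    thus "\<sigma> $ j = \<tau> $ j" using * j by (auto simp: sign_change_def signs_of_def)
  qed
qed

lemma sign_change_nonneg_eq:
  assumes "k \<in> nonneg_vecs d" "k' \<in> nonneg_vecs d" "\<sigma> \<in> signs d" "sign_change \<sigma> k' = k"
  shows "k' = k"
proof (rule eq_vecI)
  have "dim_vec k' = d" "dim_vec k = d" using assms(1,2) by (auto simp: nonneg_vecs_def)
  thus "dim_vec k' = dim_vec k" by simp
  fix j assume "j < dim_vec k"
  hence j: "j < d" using assms by (auto simp: nonneg_vecs_def)
  have "k $ j = \<sigma> $ j * k' $ j" using assms(2,4) j by (auto simp: sign_change_def nonneg_vecs_def)
  moreover have "\<sigma> $ j = 1 \<or> \<sigma> $ j = -1" using assms(3) j by (auto simp: signs_def)
  moreover have "0 \<le> k $ j" "0 \<le> k' $ j" using assms(1,2) j by (auto simp: nonneg_vecs_def)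
  ultimately show "k' $ j = k $ j" by auto
qed

section \<open>Sampling tent-transformed cosines on a lattice\<close>

lemma tent_unit_interval: "x \<in> {0..1} \<Longrightarrow> tent x \<in> {0..1}"
  by (auto simp: tent_def)

text \<open>On the right half of the interval the tent is \<open>2 - 2x\<close>, and the cosine, being even and of
  period \<open>2 \<pi>\<close>, does not see the difference from \<open>2x\<close>. This uses that \<open>k\<close> is an integer.\<close>

lemma cos_tent:
  assumes "x \<in> {0..1}"
  shows "cos (pi * of_int k * tent x) = cos (2 * pi * (of_int k * x))"
proof (cases "x \<le> 1/2")
  case True
  hence "tent x = 2 * x" by (simp add: tent_def)
  thus ?thesis by (simp add: mult_ac)
next
  case False
  hence "tent x = 2 - 2 * x" by (simp add: tent_def)
  hence "pi * of_int k * tent x = 2 * pi * of_int k - 2 * pi * (of_int k * x)"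
    by (simp only: right_diff_distrib mult_ac)
  hence "cos (pi * of_int k * tent x) = cos (2 * pi * of_int k - 2 * pi * (of_int k * x))"
    by (simp only:)
  also have "\<dots> = cos (2 * pi * (of_int k * x))"
    by (simp add: cos_diff)
  finally show ?thesis .
qed

text \<open>Each nonzero coordinate contributes \<open>2 cos \<theta> = cis \<theta> + cis (-\<theta>)\<close>, each zero coordinate the
  single term \<open>1\<close>; multiplying out gives one exponential per sign vector.\<close>

lemma prod_cos_eq_sum_signs:
  assumes x: "x \<in> carrier_vec (dim_vec k)"
  shows "of_real (2 ^ l0 k * (\<Prod>j<dim_vec k. cos (2 * pi * (of_int (k $ j) * x $ j)))) =
         (\<Sum>\<sigma>\<in>signs_of k. cis (2 * pi * (map_vec of_int (sign_change \<sigma> k) \<bullet> x)))"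
proof -
  let ?d = "dim_vec k"
  define B :: "nat \<Rightarrow> int set" where "B j = (if k $ j = 0 then {1} else {1, -1})" for j
  have cis_sum: "cis (\<Sum>j\<in>A. f j) = (\<Prod>j\<in>A. cis (f j))" if "finite A" for f and A :: "nat set"
    using that by (induction A rule: finite_induct) (auto simp: cis_mult[symmetric])
  have factor: "(\<Sum>s\<in>B j. cis (2 * pi * (of_int (s * k $ j) * x $ j))) =
      of_real ((if k $ j \<noteq> 0 then 2 else 1) * cos (2 * pi * (of_int (k $ j) * x $ j)))" for j
    by (auto simp: B_def complex_eq_iff)
  have "(\<Sum>\<sigma>\<in>signs_of k. cis (2 * pi * (map_vec of_int (sign_change \<sigma> k) \<bullet> x))) =
        (\<Sum>g\<in>PiE {..<?d} B. cis (2 * pi * (map_vec of_int (sign_change (vec ?d g) k) \<bullet> x)))"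
    using sum.reindex_bij_betw[OF bij_betw_PiE_signs_of[of k], symmetric] by (simp add: B_def[abs_def])
  also have "\<dots> = (\<Sum>g\<in>PiE {..<?d} B. \<Prod>j<?d. cis (2 * pi * (of_int (g j * k $ j) * x $ j)))"
    using x
    by (intro sum.cong refl)
       (simp add: scalar_prod_def sign_change_def sum_distrib_left cis_sum lessThan_atLeast0)
  also have "\<dots> = (\<Prod>j<?d. \<Sum>s\<in>B j. cis (2 * pi * (of_int (s * k $ j) * x $ j)))"
    by (subst prod_sum_PiE) (auto simp: B_def)
  also have "\<dots> = of_real ((\<Prod>j<?d. if k $ j \<noteq> 0 then 2 else 1) *
                           (\<Prod>j<?d. cos (2 * pi * (of_int (k $ j) * x $ j))))"
    by (simp only: factor prod.distrib of_real_prod of_real_mult)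
  also have "(\<Prod>j<?d. if k $ j \<noteq> 0 then 2 else 1 :: real) = 2 ^ l0 k"
    by (simp add: prod.If_cases l0_def Int_def)
  finally show ?thesis by simp
qed

text \<open>Reducing the coordinates of a lattice point modulo \<open>1\<close> changes the phase by an integer multiple
  of \<open>2 \<pi>\<close> only, so along the lattice an exponential runs through the powers of one root of unity.\<close>

lemma cis_lattice_point:
  assumes "h \<in> carrier_vec d" "z \<in> carrier_vec d" "1 \<le> n"
  shows "cis (2 * pi * (map_vec of_int h \<bullet> lattice_point n z i)) =
         cis (2 * pi * (of_int (h \<bullet> z) / of_nat n)) ^ i"
proof -
  have frac: "of_int ((int i * c) mod int n) / of_nat n =
      of_nat i * of_int c / of_nat n - (of_int ((int i * c) div int n) :: real)" for c
  proof -
    have "(int i * c) mod int n = int i * c - int n * ((int i * c) div int n)"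
      by (simp add: minus_mult_div_eq_mod)
    hence "real_of_int ((int i * c) mod int n) =
        of_nat i * of_int c - of_nat n * of_int ((int i * c) div int n)"
      by simp
    thus ?thesis using assms(3) by (simp add: diff_divide_distrib)
  qed
  \<comment> \<open>the total integer part discarded by the coordinatewise reduction\<close>
  define m :: int where "m = (\<Sum>j = 0..<d. h $ j * ((int i * z $ j) div int n))"
  have "map_vec of_int h \<bullet> lattice_point n z i = of_nat i * (of_int (h \<bullet> z) / of_nat n) - (of_int m :: real)"
    using assms(1,2)
    by (simp add: scalar_prod_def lattice_point_def frac m_def right_diff_distrib sum_subtractf
          sum_distrib_left sum_divide_distrib mult_ac)
  hence "cis (2 * pi * (map_vec of_int h \<bullet> lattice_point n z i)) =
         cis (real i * (2 * pi * (of_int (h \<bullet> z) / of_nat n)) - 2 * pi * of_int m)"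
    by (simp only: right_diff_distrib mult_ac)
  also have "\<dots> = cis (2 * pi * (of_int (h \<bullet> z) / of_nat n)) ^ i"
    by (simp add: cis_divide[symmetric] DeMoivre)
  finally show ?thesis .
qed

lemma cis_rational_eq_1_iff:
  assumes "1 \<le> n"
  shows "cis (2 * pi * (of_int m / of_nat n)) = 1 \<longleftrightarrow> int n dvd m"
proof
  assume "int n dvd m"
  then obtain q where "m = int n * q" by (auto elim: dvdE)
  thus "cis (2 * pi * (of_int m / of_nat n)) = 1" using assms by simp
next
  assume "cis (2 * pi * (of_int m / of_nat n)) = 1"
  hence "cos (2 * pi * (of_int m / of_nat n)) = 1" by (metis cis.simps(1) one_complex.simps(1))
  then obtain q :: int where "2 * pi * (of_int m / of_nat n) = of_int q * 2 * pi"
    by (auto simp: cos_one_2pi_int)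
  hence "(2 * pi) * (of_int m / of_nat n) = (2 * pi) * of_int q" by (simp only: mult_ac)
  hence "of_int m / of_nat n = (of_int q :: real)" unfolding mult_cancel_left by simp
  hence "(of_int m :: real) = of_int (int n * q)" using assms by (simp add: field_simps)
  hence "m = int n * q" by (simp only: of_int_eq_iff)
  thus "int n dvd m" by simp
qed

lemma character_sum:
  assumes "1 \<le> n"
  shows "(\<Sum>i<n. cis (2 * pi * (of_int m / of_nat n)) ^ i) = (if [m = 0] (mod int n) then of_nat n else 0)"
proof (cases "int n dvd m")
  case True
  thus ?thesis using cis_rational_eq_1_iff[OF assms, of m] by (simp add: cong_0_iff)
next
  case False
  have "cis (2 * pi * (of_int m / of_nat n)) ^ n = 1"
    using assms by (simp add: DeMoivre)
  thus ?thesis using cis_rational_eq_1_iff[OF assms, of m] False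
    by (simp add: cong_0_iff geometric_sum)
qed

lemma lattice_point_unit_cube:
  "z \<in> carrier_vec d \<Longrightarrow> 1 \<le> n \<Longrightarrow> lattice_point n z i \<in> unit_cube d"
proof -
  assume z: "z \<in> carrier_vec d" and n: "1 \<le> n"
  have "0 \<le> c mod int n" "c mod int n \<le> int n" for c
    using n by (simp_all add: order.strict_implies_order)
  hence "0 \<le> real_of_int (c mod int n)" "real_of_int (c mod int n) \<le> real n" for c
    by (simp, metis of_int_le_iff of_int_of_nat_eq)
  thus ?thesis using z n by (auto simp: lattice_point_def unit_cube_def)
qed

lemma tent_unit_cube: "x \<in> unit_cube d \<Longrightarrow> map_vec tent x \<in> unit_cube d"
  using tent_unit_interval by (auto simp: unit_cube_def)

text \<open>The key computation. The weight \<open>cos (2 \<pi> k \<bullet> x)\<close> is taken as the real part of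
  \<open>cis (- 2 \<pi> k \<bullet> x)\<close>, which is harmless because the tent-transformed basis function is real. In
  this way only the frequencies \<open>\<sigma>(k') - k\<close> occur, and not also \<open>\<sigma>(k') + k\<close> as in the product
  formula for two cosines.\<close>

lemma lattice_cos_coeff_cos_basis:
  assumes k: "k \<in> carrier_vec d" and k': "k' \<in> carrier_vec d" and z: "z \<in> carrier_vec d" and n: "1 \<le> n"
  shows "lattice_cos_coeff n z (cos_basis k') k = sqrt 2 ^ l0 k / sqrt 2 ^ l0 k' *
           card {\<sigma> \<in> signs_of k'. [sign_change \<sigma> k' \<bullet> z = k \<bullet> z] (mod int n)}"
proof -
  let ?x = "lattice_point n z"
  let ?C = "\<lambda>i. \<Prod>j<d. cos (2 * pi * (of_int (k' $ j) * ?x i $ j))"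
  have x: "?x i \<in> carrier_vec d" for i
    using lattice_point_unit_cube[OF z n, of i] by (auto simp: unit_cube_def)
  have pull: "map_vec of_int (sign_change \<sigma> k' - k) \<bullet> ?x i =
      map_vec of_int (sign_change \<sigma> k') \<bullet> ?x i - map_vec of_int k \<bullet> ?x i" for \<sigma> i
    using x[of i] k k'
    by (simp add: scalar_prod_def sum_subtractf[symmetric] left_diff_distrib)
  have dot: "(sign_change \<sigma> k' - k) \<bullet> z = sign_change \<sigma> k' \<bullet> z - k \<bullet> z" for \<sigma>
    using z k k' by (simp add: scalar_prod_def sum_subtractf[symmetric] left_diff_distrib)
  have summand: "2 ^ l0 k' * (?C i * cos (2 * pi * (map_vec of_int k \<bullet> ?x i))) =
      Re (\<Sum>\<sigma>\<in>signs_of k'. cis (2 * pi * (of_int ((sign_change \<sigma> k' - k) \<bullet> z) / of_nat n)) ^ i)" for i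
  proof -
    have "(\<Sum>\<sigma>\<in>signs_of k'. cis (2 * pi * (of_int ((sign_change \<sigma> k' - k) \<bullet> z) / of_nat n)) ^ i) =
          (\<Sum>\<sigma>\<in>signs_of k'. cis (2 * pi * (map_vec of_int (sign_change \<sigma> k' - k) \<bullet> ?x i)))"
      using k k' z n by (intro sum.cong refl cis_lattice_point[symmetric]) auto
    also have "\<dots> = (\<Sum>\<sigma>\<in>signs_of k'. cis (2 * pi * (map_vec of_int (sign_change \<sigma> k') \<bullet> ?x i))) *
                    cis (- (2 * pi * (map_vec of_int k \<bullet> ?x i)))"
      by (simp add: sum_distrib_right cis_mult pull right_diff_distrib)
    also have "\<dots> = of_real (2 ^ l0 k' * ?C i) * cis (- (2 * pi * (map_vec of_int k \<bullet> ?x i)))"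
      using prod_cos_eq_sum_signs[of "?x i" k'] x[of i] k' by simp
    finally show ?thesis
      by (simp only: times_complex.sel Re_complex_of_real Im_complex_of_real cis.sel cos_minus
          mult_zero_left diff_zero mult.assoc)
  qed
  have "2 ^ l0 k' * (\<Sum>i<n. ?C i * cos (2 * pi * (map_vec of_int k \<bullet> ?x i))) =
        Re (\<Sum>i<n. \<Sum>\<sigma>\<in>signs_of k'. cis (2 * pi * (of_int ((sign_change \<sigma> k' - k) \<bullet> z) / of_nat n)) ^ i)"
    by (simp only: sum_distrib_left summand Re_sum)
  also have "\<dots> = Re (\<Sum>\<sigma>\<in>signs_of k'. if [sign_change \<sigma> k' \<bullet> z = k \<bullet> z] (mod int n) then of_nat n else 0)"
    by (subst sum.swap) (simp only: character_sum[OF n] dot cong_diff_iff_cong_0)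
  also have "\<dots> = of_nat n * card {\<sigma> \<in> signs_of k'. [sign_change \<sigma> k' \<bullet> z = k \<bullet> z] (mod int n)}"
    by (simp add: sum.If_cases Int_def)
  finally have Q: "(\<Sum>i<n. ?C i * cos (2 * pi * (map_vec of_int k \<bullet> ?x i))) =
      of_nat n * card {\<sigma> \<in> signs_of k'. [sign_change \<sigma> k' \<bullet> z = k \<bullet> z] (mod int n)} / 2 ^ l0 k'"
    by (simp add: field_simps)
  have basis: "cos_basis k' (map_vec tent (?x i)) = sqrt 2 ^ l0 k' * ?C i" for i
  proof -
    have "cos (pi * of_int (k' $ j) * map_vec tent (?x i) $ j) =
          cos (2 * pi * (of_int (k' $ j) * ?x i $ j))" if "j < d" for j
      using lattice_point_unit_cube[OF z n, of i] that
      by (subst cos_tent[symmetric]) (auto simp: unit_cube_def)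
    thus ?thesis using k' by (auto simp: cos_basis_def)
  qed
  have "lattice_cos_coeff n z (cos_basis k') k = sqrt 2 ^ l0 k' * sqrt 2 ^ l0 k *
          (\<Sum>i<n. ?C i * cos (2 * pi * (map_vec of_int k \<bullet> ?x i))) / of_nat n"
    by (simp add: lattice_cos_coeff_def lattice_rule_def basis sum_distrib_left mult_ac)
  also have "\<dots> = sqrt 2 ^ l0 k / sqrt 2 ^ l0 k' *
      card {\<sigma> \<in> signs_of k'. [sign_change \<sigma> k' \<bullet> z = k \<bullet> z] (mod int n)}"
  proof -
    have "(2::real) ^ l0 k' = sqrt 2 ^ l0 k' * sqrt 2 ^ l0 k'"
      by (simp add: power_mult_distrib[symmetric])
    thus ?thesis using n unfolding Q by (simp add: field_simps)
  qed
  finally show ?thesis .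
qed

section \<open>Orthonormality of the cosine basis\<close>

lemma has_integral_cos_frequency:
  "has_bochner_integral lborel (\<lambda>t. cos (pi * of_int m * t) * indicator {0..1} t) (if m = 0 then 1 else 0)"
proof (cases "m = 0")
  case True
  have "has_bochner_integral lborel (\<lambda>t::real. 1 * indicator {0..1} t) (1 - 0 :: real)"
    by (rule has_bochner_integral_FTC_Icc_real[of 0 1 "\<lambda>t. t"]) (auto intro!: derivative_eq_intros)
  with True show ?thesis by simp
next
  case False
  have "has_bochner_integral lborel (\<lambda>t. cos (pi * of_int m * t) * indicator {0..1} t)
          (sin (pi * of_int m * 1) / (pi * of_int m) - sin (pi * of_int m * 0) / (pi * of_int m))"
    using False
    by (intro has_bochner_integral_FTC_Icc_real[of 0 1 "\<lambda>t. sin (pi * of_int m * t) / (pi * of_int m)"])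
       (auto intro!: derivative_eq_intros continuous_intros)
  moreover have "sin (pi * of_int m) = 0" by (simp add: sin_zero_iff_int2 mult.commute)
  ultimately show ?thesis using False by simp
qed

text \<open>Distributing the normalisation \<open>sqrt 2 ^ l0 k\<close> over the coordinates makes the basis function a
  pure product, to which the integral over the product measure applies factor by factor.\<close>

definition cos_factor :: "int \<Rightarrow> real \<Rightarrow> real" where
  "cos_factor m t = (if m = 0 then 1 else sqrt 2) * cos (pi * of_int m * t)"

lemma cos_basis_eq_prod: "cos_basis k x = (\<Prod>j<dim_vec k. cos_factor (k $ j) (x $ j))"
proof -
  have "(\<Prod>j<dim_vec k. if k $ j = 0 then 1 else sqrt 2) = sqrt 2 ^ l0 k"
    by (simp add: prod.If_cases l0_def Int_def)
  thus ?thesis by (simp add: cos_basis_def cos_factor_def prod.distrib)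
qed

text \<open>By the product formula the integral picks out \<open>a - b = 0\<close> and \<open>a + b = 0\<close>. For nonnegative
  \<open>a\<close> and \<open>b\<close> the latter means \<open>a = b = 0\<close>, where both terms contribute; otherwise only one
  does, and the factors \<open>sqrt 2\<close> make up for it.\<close>

lemma cos_factor_orthonormal:
  assumes "0 \<le> a" "0 \<le> b"
  shows "has_bochner_integral lborel (\<lambda>t. cos_factor a t * cos_factor b t * indicator {0..1} t)
           (if a = b then 1 else 0)"
proof -
  define c where "c m = (if m = 0 then 1 else sqrt 2 :: real)" for m :: int
  have "has_bochner_integral lborel
          (\<lambda>t. c a * c b / 2 * (cos (pi * of_int (a - b) * t) * indicator {0..1} t
                                + cos (pi * of_int (a + b) * t) * indicator {0..1} t))
          (c a * c b / 2 * ((if a - b = 0 then 1 else 0) + (if a + b = 0 then 1 else 0)))"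
    by (intro has_bochner_integral_mult_right has_bochner_integral_add has_integral_cos_frequency)
  moreover have "cos_factor a t * cos_factor b t * indicator {0..1} t =
      c a * c b / 2 * (cos (pi * of_int (a - b) * t) * indicator {0..1} t
                     + cos (pi * of_int (a + b) * t) * indicator {0..1} t)" for t
  proof -
    have "cos (pi * of_int a * t) * cos (pi * of_int b * t) =
          (cos (pi * of_int (a - b) * t) + cos (pi * of_int (a + b) * t)) / 2"
      by (subst cos_times_cos) (simp add: algebra_simps)
    hence "c a * c b * (cos (pi * of_int a * t) * cos (pi * of_int b * t)) * indicator {0..1} t =
           c a * c b * ((cos (pi * of_int (a - b) * t) + cos (pi * of_int (a + b) * t)) / 2)
             * indicator {0..1} t"
      by (simp only:)
    moreover have "cos_factor m t = c m * cos (pi * of_int m * t)" for m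
      by (simp add: cos_factor_def c_def)
    ultimately show ?thesis by (simp only: mult_ac distrib_left add_divide_distrib
          times_divide_eq_left times_divide_eq_right)
  qed
  moreover have "c a * c b / 2 * ((if a - b = 0 then 1 else 0) + (if a + b = 0 then 1 else 0)) =
      (if a = b then 1 else 0)"
    using assms by (auto simp: c_def)
  ultimately show ?thesis by (simp only:)
qed

lemma cos_basis_orthonormal:
  assumes k: "k \<in> nonneg_vecs d" and k': "k' \<in> nonneg_vecs d"
  shows "cos_coeff (cos_basis k') k = (if k = k' then 1 else 0)"
proof -
  interpret product_sigma_finite "\<lambda>_::nat. lborel :: real measure"
    by (simp add: product_sigma_finite_def sigma_finite_lborel)
  have dim: "dim_vec k = d" "dim_vec k' = d" using k k' by (auto simp: nonneg_vecs_def)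
  let ?f = "\<lambda>j t. cos_factor (k' $ j) t * cos_factor (k $ j) t * indicator {0..1} t :: real"
  have f: "has_bochner_integral lborel (?f j) (if k' $ j = k $ j then 1 else 0)" if "j < d" for j
    using that k k' by (intro cos_factor_orthonormal) (auto simp: nonneg_vecs_def)
  have "cos_coeff (cos_basis k') k = (LINT x|(Pi\<^sub>M {..<d} (\<lambda>_. lborel)). (\<Prod>j<d. ?f j (x j)))"
    unfolding cos_coeff_def cube_integral_def set_lebesgue_integral_def dim
  proof (rule Bochner_Integration.integral_cong[OF refl])
    fix x assume "x \<in> space (Pi\<^sub>M {..<d} (\<lambda>_. lborel :: real measure))"
    hence ext: "x \<in> extensional {..<d}" by (simp add: space_PiM PiE_def)
    \<comment> \<open>the indicator of the cube splits into factors on extensional functions\<close>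
    have "indicator ({..<d} \<rightarrow>\<^sub>E {0..1::real}) x = (\<Prod>j<d. indicator {0..1} (x j) :: real)"
    proof (cases "x \<in> {..<d} \<rightarrow>\<^sub>E {0..1}")
      case True
      thus ?thesis by (auto simp: PiE_iff intro!: prod.neutral[symmetric])
    next
      case False
      then obtain j where "j < d" "x j \<notin> {0..1}" using ext by (auto simp: PiE_def Pi_def)
      hence "(\<Prod>j<d. indicator {0..1} (x j) :: real) = 0" by (intro prod_zero bexI[of _ j]) auto
      with False show ?thesis by simp
    qed
    thus "indicator ({..<d} \<rightarrow>\<^sub>E {0..1}) x *\<^sub>R (cos_basis k' (vec d x) * cos_basis k (vec d x)) =
          (\<Prod>j<d. ?f j (x j))"
      by (simp add: cos_basis_eq_prod dim prod.distrib)
  qed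
  also have "\<dots> = (\<Prod>j<d. integral\<^sup>L lborel (?f j))"
    using f by (intro product_integral_prod) (auto simp: has_bochner_integral_iff)
  also have "\<dots> = (\<Prod>j<d. if k' $ j = k $ j then 1 else 0)"
    using f by (intro prod.cong refl) (auto simp: has_bochner_integral_iff)
  also have "\<dots> = (if k = k' then 1 else 0)"
  proof (cases "k = k'")
    case False
    then obtain j where "j < d" "k $ j \<noteq> k' $ j" using dim by (metis eq_vecI)
    thus ?thesis using False by (auto intro!: prod_zero)
  qed simp
  finally show ?thesis .
qed

lemma cos_basis_in_cos_space:
  assumes "finite \<Lambda>" "\<Lambda> \<subseteq> nonneg_vecs d" "k \<in> \<Lambda>"
  shows "cos_basis k \<in> cos_space d \<Lambda>"
proof -
  have "(\<Sum>l\<in>\<Lambda>. cos_coeff (cos_basis k) l * cos_basis l x) = cos_basis k x" for x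
  proof -
    have "(\<Sum>l\<in>\<Lambda>. cos_coeff (cos_basis k) l * cos_basis l x) =
          (\<Sum>l\<in>\<Lambda>. if l = k then cos_basis l x else 0)"
    proof (rule sum.cong[OF refl])
      fix l assume "l \<in> \<Lambda>"
      hence "cos_coeff (cos_basis k) l = (if l = k then 1 else 0)"
        using assms by (intro cos_basis_orthonormal) auto
      thus "cos_coeff (cos_basis k) l * cos_basis l x = (if l = k then cos_basis l x else 0)"
        by simp
    qed
    thus ?thesis using assms by simp
  qed
  thus ?thesis by (simp add: cos_space_def)
qed

section \<open>The aliasing criterion\<close>

lemma lattice_cos_coeff_cos_space:
  assumes "f \<in> cos_space d \<Lambda>" "z \<in> carrier_vec d" "1 \<le> n"
  shows "lattice_cos_coeff n z f k = (\<Sum>l\<in>\<Lambda>. cos_coeff f l * lattice_cos_coeff n z (cos_basis l) k)"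
proof -
  let ?y = "\<lambda>i. map_vec tent (lattice_point n z i)"
  let ?w = "\<lambda>i. sqrt 2 ^ l0 k * cos (2 * pi * (map_vec of_int k \<bullet> lattice_point n z i))"
  have "f (?y i) = (\<Sum>l\<in>\<Lambda>. cos_coeff f l * cos_basis l (?y i))" for i
    using assms(1) tent_unit_cube[OF lattice_point_unit_cube[OF assms(2,3)]]
    by (auto simp: cos_space_def)
  hence "lattice_cos_coeff n z f k =
      (\<Sum>i<n. \<Sum>l\<in>\<Lambda>. cos_coeff f l * (cos_basis l (?y i) * ?w i)) / of_nat n"
    by (simp add: lattice_cos_coeff_def lattice_rule_def sum_distrib_right mult.assoc)
  also have "\<dots> = (\<Sum>l\<in>\<Lambda>. cos_coeff f l * ((\<Sum>i<n. cos_basis l (?y i) * ?w i) / of_nat n))"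
    by (subst sum.swap) (simp add: sum_divide_distrib sum_distrib_left)
  finally show ?thesis by (simp add: lattice_cos_coeff_def lattice_rule_def)
qed

text \<open>Orthonormality places the basis functions themselves in the space and gives their true
  coefficients, which makes the delta condition necessary; linearity makes it sufficient.\<close>

lemma reconstructs_iff_basis:
  assumes fin: "finite \<Lambda>" and nn: "\<Lambda> \<subseteq> nonneg_vecs d" and z: "z \<in> carrier_vec d" and n: "1 \<le> n"
  shows "reconstructs d n z \<Lambda> \<longleftrightarrow>
    (\<forall>k\<in>\<Lambda>. \<forall>k'\<in>\<Lambda>. lattice_cos_coeff n z (cos_basis k') k = (if k = k' then 1 else 0))"
proof
  assume R: "reconstructs d n z \<Lambda>"
  show "\<forall>k\<in>\<Lambda>. \<forall>k'\<in>\<Lambda>. lattice_cos_coeff n z (cos_basis k') k = (if k = k' then 1 else 0)"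
  proof (intro ballI)
    fix k k' assume kk: "k \<in> \<Lambda>" "k' \<in> \<Lambda>"
    hence "cos_coeff (cos_basis k') k = lattice_cos_coeff n z (cos_basis k') k"
      using R cos_basis_in_cos_space[OF fin nn] by (auto simp: reconstructs_def)
    thus "lattice_cos_coeff n z (cos_basis k') k = (if k = k' then 1 else 0)"
      using cos_basis_orthonormal[of k d k'] subsetD[OF nn] kk by simp
  qed
next
  assume B: "\<forall>k\<in>\<Lambda>. \<forall>k'\<in>\<Lambda>. lattice_cos_coeff n z (cos_basis k') k = (if k = k' then 1 else 0)"
  have "cos_coeff f k = lattice_cos_coeff n z f k" if f: "f \<in> cos_space d \<Lambda>" and k: "k \<in> \<Lambda>" for f k
  proof -
    have "lattice_cos_coeff n z f k = (\<Sum>l\<in>\<Lambda>. cos_coeff f l * (if k = l then 1 else 0))"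
      using B k by (simp add: lattice_cos_coeff_cos_space[OF f z n])
    also have "\<dots> = (\<Sum>l\<in>\<Lambda>. if k = l then cos_coeff f l else 0)"
      by (intro sum.cong) auto
    finally show ?thesis using fin k by simp
  qed
  thus "reconstructs d n z \<Lambda>" by (simp add: reconstructs_def)
qed

text \<open>On the diagonal the all-ones sign vector is always counted, so the count must be exactly \<open>1\<close>. Off
  the diagonal no sign change of \<open>k'\<close> equals \<open>k\<close>, so the count, which has a
  positive factor in front, must be \<open>0\<close>.\<close>

lemma lattice_cos_coeff_eq_delta_iff:
  assumes k: "k \<in> nonneg_vecs d" and k': "k' \<in> nonneg_vecs d" and z: "z \<in> carrier_vec d" and n: "1 \<le> n"
  shows "lattice_cos_coeff n z (cos_basis k') k = (if k = k' then 1 else 0) \<longleftrightarrow>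
    (\<forall>\<sigma>\<in>signs_of k'. sign_change \<sigma> k' \<noteq> k \<longrightarrow> \<not> [sign_change \<sigma> k' \<bullet> z = k \<bullet> z] (mod int n))"
proof -
  define S where "S = {\<sigma> \<in> signs_of k'. [sign_change \<sigma> k' \<bullet> z = k \<bullet> z] (mod int n)}"
  have finS: "finite S" by (simp add: S_def)
  have carr: "k \<in> carrier_vec d" "k' \<in> carrier_vec d" using k k' by (auto simp: nonneg_vecs_def)
  have L: "lattice_cos_coeff n z (cos_basis k') k = sqrt 2 ^ l0 k / sqrt 2 ^ l0 k' * card S"
    unfolding S_def by (rule lattice_cos_coeff_cos_basis[OF carr z n])
  show ?thesis
  proof (cases "k = k'")
    case True
    let ?e = "vec (dim_vec k') (\<lambda>_. 1) :: int vec"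
    have e: "?e \<in> S" using True by (simp add: S_def one_in_signs_of)
    have uniq: "sign_change \<sigma> k' = k \<longleftrightarrow> \<sigma> = ?e" if "\<sigma> \<in> signs_of k'" for \<sigma>
      using inj_onD[OF inj_on_sign_change, of \<sigma> k' ?e] that True one_in_signs_of[of k'] by auto
    have "card S = 1 \<longleftrightarrow> S = {?e}" using e by (auto simp: card_1_singleton_iff)
    also have "\<dots> \<longleftrightarrow> (\<forall>\<sigma>\<in>signs_of k'. sign_change \<sigma> k' \<noteq> k \<longrightarrow>
        \<not> [sign_change \<sigma> k' \<bullet> z = k \<bullet> z] (mod int n))"
      using e uniq by (auto simp: S_def)
    finally show ?thesis using L True by simp
  next
    case False
    have "sign_change \<sigma> k' \<noteq> k" if "\<sigma> \<in> signs_of k'" for \<sigma>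
      using sign_change_nonneg_eq[OF k k', of \<sigma>] that False carr by (auto simp: signs_of_def)
    moreover have "card S = 0 \<longleftrightarrow> S = {}" using finS by simp
    ultimately show ?thesis using L False by (auto simp: S_def)
  qed
qed

lemma aliasing_iff_sumset:
  assumes "\<Lambda> \<subseteq> carrier_vec d" and z: "z \<in> carrier_vec d"
  shows "(\<forall>k \<in> \<Lambda>. \<forall>k' \<in> \<Lambda>. \<forall>\<sigma> \<in> signs_of k'. sign_change \<sigma> k' \<noteq> k \<longrightarrow>
             \<not> [sign_change \<sigma> k' \<bullet> z = k \<bullet> z] (mod int n)) \<longleftrightarrow>
         (\<forall>h \<in> (\<Lambda> + mirror \<Lambda>) - {0\<^sub>v d}. \<not> [h \<bullet> z = 0] (mod int n))"
    (is "?A \<longleftrightarrow> ?B")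
proof -
  have diff: "(k - l) \<bullet> z = k \<bullet> z - l \<bullet> z" if "k \<in> carrier_vec d" "l \<in> carrier_vec d" for k l
    using that z by (simp add: scalar_prod_def sum_subtractf[symmetric] left_diff_distrib)
  have zero: "k - l = 0\<^sub>v d \<longleftrightarrow> l = k" if "k \<in> carrier_vec d" "l \<in> carrier_vec d" for k l :: "int vec"
    using that by (auto simp: vec_eq_iff)
  have sumset: "\<Lambda> + mirror \<Lambda> = {k - sign_change \<sigma> k' | k k' \<sigma>. k \<in> \<Lambda> \<and> k' \<in> \<Lambda> \<and> \<sigma> \<in> signs_of k'}"
  proof (intro equalityI subsetI)
    fix h assume "h \<in> \<Lambda> + mirror \<Lambda>"
    then obtain k k' \<sigma> where *: "k \<in> \<Lambda>" "k' \<in> \<Lambda>" "\<sigma> \<in> signs (dim_vec k')" "h = k + sign_change \<sigma> k'"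
      by (auto simp: set_plus_def mirror_def)
    \<comment> \<open>negate the signs, but keep the value prescribed where \<open>k'\<close> vanishes\<close>
    define \<tau> where "\<tau> = vec (dim_vec k') (\<lambda>j. if k' $ j = 0 then 1 else - \<sigma> $ j)"
    have "\<tau> \<in> signs_of k'" using *(3) by (auto simp: \<tau>_def signs_of_def signs_def)
    moreover have "h = k - sign_change \<tau> k'"
      using * assms by (auto simp: \<tau>_def sign_change_def intro!: eq_vecI)
    ultimately show "h \<in> {k - sign_change \<sigma> k' | k k' \<sigma>. k \<in> \<Lambda> \<and> k' \<in> \<Lambda> \<and> \<sigma> \<in> signs_of k'}"
      using * by blast
  next
    fix h assume "h \<in> {k - sign_change \<sigma> k' | k k' \<sigma>. k \<in> \<Lambda> \<and> k' \<in> \<Lambda> \<and> \<sigma> \<in> signs_of k'}"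
    then obtain k k' \<sigma> where *: "k \<in> \<Lambda>" "k' \<in> \<Lambda>" "\<sigma> \<in> signs_of k'" "h = k - sign_change \<sigma> k'"
      by blast
    have "- \<sigma> \<in> signs (dim_vec k')" using *(3) by (auto simp: signs_of_def signs_def)
    moreover have "h = k + sign_change (- \<sigma>) k'"
      using * assms by (auto simp: sign_change_def signs_of_def signs_def intro!: eq_vecI)
    ultimately show "h \<in> \<Lambda> + mirror \<Lambda>"
      using * by (auto simp: mirror_def intro!: set_plus_intro)
  qed
  have carr: "k \<in> carrier_vec d" "sign_change \<sigma> k \<in> carrier_vec d" if "k \<in> \<Lambda>" for k \<sigma>
    using that assms by auto
  have cong: "[(k - l) \<bullet> z = 0] (mod int n) \<longleftrightarrow> [l \<bullet> z = k \<bullet> z] (mod int n)"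
    if "k \<in> carrier_vec d" "l \<in> carrier_vec d" for k l
    using that by (simp only: diff cong_diff_iff_cong_0) (rule cong_sym_eq)
  show ?thesis
  proof
    assume A: ?A
    show ?B
    proof
      fix h assume h: "h \<in> (\<Lambda> + mirror \<Lambda>) - {0\<^sub>v d}"
      then obtain k k' \<sigma> where *: "k \<in> \<Lambda>" "k' \<in> \<Lambda>" "\<sigma> \<in> signs_of k'" "h = k - sign_change \<sigma> k'"
        unfolding sumset by blast
      thus "\<not> [h \<bullet> z = 0] (mod int n)"
        using A h by (auto simp: cong zero carr)
    qed
  next
    assume B: ?B
    show ?A
    proof (intro ballI impI)
      fix k k' \<sigma> assume *: "k \<in> \<Lambda>" "k' \<in> \<Lambda>" "\<sigma> \<in> signs_of k'" "sign_change \<sigma> k' \<noteq> k"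
      hence "k - sign_change \<sigma> k' \<in> (\<Lambda> + mirror \<Lambda>) - {0\<^sub>v d}"
        unfolding sumset by (auto simp: zero carr)
      thus "\<not> [sign_change \<sigma> k' \<bullet> z = k \<bullet> z] (mod int n)"
        using B cong carr * by blast
    qed
  qed
qed

section \<open>Component-by-component construction\<close>

text \<open>Here \<open>A\<close> is the index set handled by the previous components \<open>z\<close>, and \<open>B\<close> the one in the next
  dimension. The pigeonhole count is tight: both the candidate \<open>c = 0\<close> and the index \<open>h = 0\<close> are
  left out, so \<open>n - 1\<close> candidates face at most \<open>card B - 1 < n - 1\<close> indices. Membership of \<open>0\<close>
  in \<open>B\<close> is what makes this work.\<close>

lemma next_component_exists:
  assumes "prime n" and B: "finite B" "B \<subseteq> carrier_vec (Suc s)" "card B < n"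
    and zero: "B \<noteq> {} \<Longrightarrow> 0\<^sub>v (Suc s) \<in> B"
    and small: "\<And>h. h \<in> B \<Longrightarrow> \<bar>h $ s\<bar> < int n"
    and drop_last: "\<And>h. h \<in> B \<Longrightarrow> h $ s = 0 \<Longrightarrow> vec_first h s \<in> A"
    and z: "z \<in> carrier_vec s" "nonvanishing_mod n A z"
  shows "\<exists>c \<in> {1..int n - 1}. nonvanishing_mod n B (z @\<^sub>v vec 1 (\<lambda>_. c))"
proof (rule ccontr)
  assume "\<not> ?thesis"
  hence "\<forall>c\<in>{1..int n - 1}. \<exists>h\<in>B - {0\<^sub>v (Suc s)}. [h \<bullet> (z @\<^sub>v vec 1 (\<lambda>_. c)) = 0] (mod int n)"
    using z by (auto simp: nonvanishing_mod_def)
  then obtain g where g: "\<And>c. c \<in> {1..int n - 1} \<Longrightarrow> g c \<in> B - {0\<^sub>v (Suc s)}"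
      "\<And>c. c \<in> {1..int n - 1} \<Longrightarrow> [g c \<bullet> (z @\<^sub>v vec 1 (\<lambda>_. c)) = 0] (mod int n)"
    by metis
  have dot: "h \<bullet> (z @\<^sub>v vec 1 (\<lambda>_. c)) = vec_first h s \<bullet> z + h $ s * c"
    if "h \<in> carrier_vec (Suc s)" for h c
    using that z by (auto simp: scalar_prod_def vec_first_def)
  have "inj_on g {1..int n - 1}"
  proof (rule inj_onI)
    fix c c' assume c: "c \<in> {1..int n - 1}" "c' \<in> {1..int n - 1}" "g c = g c'"
    let ?h = "g c"
    have h: "?h \<in> B" "?h \<noteq> 0\<^sub>v (Suc s)" "?h \<in> carrier_vec (Suc s)" using g(1)[OF c(1)] B by auto
    have dv: "int n dvd vec_first ?h s \<bullet> z + ?h $ s * c" "int n dvd vec_first ?h s \<bullet> z + ?h $ s * c'"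
      using g(2)[OF c(1)] g(2)[OF c(2)] unfolding c(3)[symmetric] dot[OF h(3)] cong_0_iff
      by auto
    \<comment> \<open>otherwise the offending congruence already held one dimension lower\<close>
    have "?h $ s \<noteq> 0"
    proof
      assume 0: "?h $ s = 0"
      have "vec_first ?h s \<noteq> 0\<^sub>v s"
      proof
        assume "vec_first ?h s = 0\<^sub>v s"
        hence "?h $ j = 0" if "j < s" for j
          using that by (auto simp: vec_first_def vec_eq_iff)
        thus False using 0 h(2,3) by (auto simp: vec_eq_iff less_Suc_eq)
      qed
      thus False using drop_last[OF h(1) 0] z dv 0 by (auto simp: nonvanishing_mod_def cong_0_iff)
    qed
    hence "\<not> int n dvd ?h $ s" using small[OF h(1)] by (auto dest: dvd_imp_le_int)
    moreover have "int n dvd ?h $ s * (c - c')"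
      using dvd_diff[OF dv] by (simp add: algebra_simps)
    ultimately have "int n dvd c - c'" using \<open>prime n\<close> by (simp add: prime_dvd_mult_iff)
    moreover have "\<bar>c - c'\<bar> < int n" using c by auto
    ultimately have "c - c' = 0" using dvd_imp_le_int[of "c - c'" "int n"] by linarith
    thus "c = c'" by simp
  qed
  moreover have "g ` {1..int n - 1} \<subseteq> B - {0\<^sub>v (Suc s)}" by (rule image_subsetI) (rule g(1))
  ultimately have le: "card {1..int n - 1} \<le> card (B - {0\<^sub>v (Suc s)})"
    using B(1) by (intro card_inj_on_le[of g]) simp_all
  have "n \<ge> 2" using \<open>prime n\<close> by (simp add: prime_ge_2_nat)
  hence "B \<noteq> {}" using le by auto
  hence "card (B - {0\<^sub>v (Suc s)}) = card B - 1" using zero by (simp add: card_Diff_singleton)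
  moreover have "card B > 0" using \<open>B \<noteq> {}\<close> B(1) by (simp add: card_gt_0_iff)
  ultimately show False using le B(3) by auto
qed

lemma zero_sections_subset_projections: "zero_sections d A s \<subseteq> projections d A s"
  by (auto simp: zero_sections_def projections_def)

lemma projections_eq_image:
  assumes "A \<subseteq> carrier_vec d" "s \<le> d"
  shows "projections d A s = (\<lambda>h. vec_first h s) ` A"
proof (intro equalityI subsetI)
  fix h assume "h \<in> projections d A s"
  then obtain g where "h \<in> carrier_vec s" "h @\<^sub>v g \<in> A" by (auto simp: projections_def)
  moreover from this have "vec_first (h @\<^sub>v g) s = h" by (auto simp: vec_first_def)
  ultimately show "h \<in> (\<lambda>h. vec_first h s) ` A" by (metis imageI)
next
  fix h assume "h \<in> (\<lambda>h. vec_first h s) ` A"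
  then obtain a where a: "a \<in> A" "h = vec_first a s" by blast
  hence "vec_first a s @\<^sub>v vec_last a (d - s) = a"
    using assms by (intro vec_first_last_append) auto
  thus "h \<in> projections d A s" using a by (auto simp: projections_def intro!: bexI[of _ "vec_last a (d - s)"])
qed

lemma append_vec_empty: "v \<in> carrier_vec 0 \<Longrightarrow> h @\<^sub>v v = h"
  by (auto intro!: eq_vecI)

text \<open>Both kinds of projection are handled alike: each lies in the image of \<open>A\<close> under truncation,
  hence is no larger than \<open>A\<close> and has entries no larger, and each contains the truncation of those
  of its members one dimension up whose last entry is zero.\<close>

lemma cbc_constructible_if_large_prime:
  assumes "prime n" and A: "finite A" "A \<subseteq> carrier_vec d" "card A < n"
    and zero: "A \<noteq> {} \<Longrightarrow> 0\<^sub>v d \<in> A"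
    and small: "\<And>h j. h \<in> A \<Longrightarrow> j < d \<Longrightarrow> \<bar>h $ j\<bar> < int n"
  shows "cbc_constructible d n A (zero_sections d A)" "cbc_constructible d n A (projections d A)"
proof -
  have step: "\<exists>c \<in> {1..int n - 1}. nonvanishing_mod n (P (Suc s)) (z @\<^sub>v vec 1 (\<lambda>_. c))"
    if s: "s < d" and z: "z \<in> gen_vecs n s" "nonvanishing_mod n (P s) z"
      and P: "P = zero_sections d A \<or> P = projections d A" for P s z
  proof (rule next_component_exists[OF \<open>prime n\<close>])
    have sub: "P (Suc s) \<subseteq> (\<lambda>h. vec_first h (Suc s)) ` A"
      using P zero_sections_subset_projections[of d A "Suc s"] projections_eq_image[OF A(2), of "Suc s"] s
      by auto
    show "finite (P (Suc s))" using sub A(1) by (meson finite_imageI finite_subset)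
    have "card (P (Suc s)) \<le> card A" using sub A(1) by (rule surj_card_le[rotated])
    thus "card (P (Suc s)) < n" using A(3) by simp
    show "P (Suc s) \<subseteq> carrier_vec (Suc s)" using P by (auto simp: zero_sections_def projections_def)
    show "0\<^sub>v (Suc s) \<in> P (Suc s)" if "P (Suc s) \<noteq> {}"
    proof -
      have "0\<^sub>v d \<in> A" using that sub zero by blast
      moreover have "0\<^sub>v (Suc s) @\<^sub>v 0\<^sub>v (d - Suc s) = (0\<^sub>v d :: int vec)"
        using s by (auto intro!: eq_vecI)
      ultimately have "0\<^sub>v (Suc s) \<in> zero_sections d A (Suc s)" by (simp add: zero_sections_def)
      thus ?thesis using P zero_sections_subset_projections[of d A "Suc s"] by auto
    qed
    show "\<bar>h $ s\<bar> < int n" if "h \<in> P (Suc s)" for h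
      using that sub s small by (auto simp: vec_first_def)
    show "vec_first h s \<in> P s" if "h \<in> P (Suc s)" "h $ s = 0" for h
    proof -
      have "vec_first h s @\<^sub>v 0\<^sub>v (d - s) = h @\<^sub>v 0\<^sub>v (d - Suc s)" if "h \<in> carrier_vec (Suc s)"
        using that \<open>h $ s = 0\<close> s by (auto intro!: eq_vecI simp: vec_first_def less_Suc_eq)
      moreover have "vec_first (vec_first a (Suc s)) s = vec_first a s" for a :: "int vec"
        by (auto simp: vec_first_def)
      ultimately show ?thesis
        using P that(1) s projections_eq_image[OF A(2), of "Suc s"] projections_eq_image[OF A(2), of s]
        by (auto simp: zero_sections_def)
    qed
    show "z \<in> carrier_vec s" using z by (simp add: gen_vecs_def)
  qed (use z in auto)
  have "\<exists>g::int vec. g \<in> carrier_vec 0" using zero_carrier_vec by blast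
  hence full: "zero_sections d A d = A" "projections d A d = A"
    using A(2) by (auto simp: zero_sections_def projections_def append_vec_empty)
  show "cbc_constructible d n A (zero_sections d A)" "cbc_constructible d n A (projections d A)"
    using step full by (auto simp: cbc_constructible_def)
qed

lemma cbc_constructible_generating_vector:
  assumes cbc: "cbc_constructible d n A P" and P0: "P 0 \<subseteq> carrier_vec 0"
  shows "\<exists>z \<in> gen_vecs n d. nonvanishing_mod n A z"
proof -
  have "\<exists>z \<in> gen_vecs n s. nonvanishing_mod n (P s) z" if "s \<le> d" for s
    using that
  proof (induction s)
    case 0
    have "h = 0\<^sub>v 0" if "h \<in> P 0" for h 
    proof -
      have "h \<in> carrier_vec 0" using that P0 by blast
      thus ?thesis by auto
    qed
    hence "P 0 - {0\<^sub>v 0} = {}" by blast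
    thus ?case by (intro bexI[of _ "0\<^sub>v 0"]) (auto simp: nonvanishing_mod_def gen_vecs_def)
  next
    case (Suc s)
    then obtain z where z: "z \<in> gen_vecs n s" "nonvanishing_mod n (P s) z" by auto
    then obtain c where c: "c \<in> {1..int n - 1}" "nonvanishing_mod n (P (Suc s)) (z @\<^sub>v vec 1 (\<lambda>_. c))"
      using cbc Suc.prems unfolding cbc_constructible_def by (meson Suc_le_lessD)
    moreover have "z @\<^sub>v vec 1 (\<lambda>_. c) \<in> gen_vecs n (Suc s)"
      using z(1) c(1) by (auto simp: gen_vecs_def less_Suc_eq intro!: carrier_vecI)
    ultimately show ?case by blast
  qed
  thus ?thesis using cbc by (auto simp: cbc_constructible_def)
qed

lemma abs_le_max_component:
  assumes "finite \<Lambda>" "k \<in> \<Lambda>" "j < dim_vec k"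
  shows "\<bar>k $ j\<bar> \<le> max_component \<Lambda>"
proof -
  have "{\<bar>k $ j\<bar> | k j. k \<in> \<Lambda> \<and> j < dim_vec k} = (\<Union>k\<in>\<Lambda>. (\<lambda>j. \<bar>k $ j\<bar>) ` {..<dim_vec k})"
    by auto
  hence "finite {\<bar>k $ j\<bar> | k j. k \<in> \<Lambda> \<and> j < dim_vec k}" using assms(1) by simp
  thus ?thesis unfolding max_component_def using assms(2,3) by (intro Max_ge) auto
qed

text \<open>The sumset contains zero, if it is not empty, because \<open>k\<close> and its full reflection \<open>-k\<close> cancel.\<close>

lemma sumset_mirror:
  assumes "finite \<Lambda>" "\<Lambda> \<subseteq> carrier_vec d"
  shows finite_sumset_mirror: "finite (\<Lambda> + mirror \<Lambda>)"
    and sumset_mirror_carrier: "\<Lambda> + mirror \<Lambda> \<subseteq> carrier_vec d"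
    and zero_in_sumset_mirror: "\<Lambda> + mirror \<Lambda> \<noteq> {} \<Longrightarrow> 0\<^sub>v d \<in> \<Lambda> + mirror \<Lambda>"
    and abs_sumset_mirror_le:
      "h \<in> \<Lambda> + mirror \<Lambda> \<Longrightarrow> j < d \<Longrightarrow> \<bar>h $ j\<bar> \<le> 2 * max_component \<Lambda>"
proof -
  have "mirror \<Lambda> = (\<Union>k\<in>\<Lambda>. (\<lambda>\<sigma>. sign_change \<sigma> k) ` signs (dim_vec k))"
    by (auto simp: mirror_def)
  hence "finite (mirror \<Lambda>)" using assms(1) by (simp add: finite_signs)
  thus "finite (\<Lambda> + mirror \<Lambda>)" using assms(1) by (rule finite_set_plus[rotated])
  show "\<Lambda> + mirror \<Lambda> \<subseteq> carrier_vec d"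
    using assms(2) by (fastforce simp: set_plus_def mirror_def intro!: carrier_vecI)
  show "0\<^sub>v d \<in> \<Lambda> + mirror \<Lambda>" if ne: "\<Lambda> + mirror \<Lambda> \<noteq> {}"
  proof -
    obtain k where k: "k \<in> \<Lambda>" using ne by (auto simp: set_plus_def)
    hence "dim_vec k = d" using assms(2) by auto
    hence "vec d (\<lambda>_. -1) \<in> signs (dim_vec k)" by (auto simp: signs_def)
    hence "sign_change (vec d (\<lambda>_. -1)) k \<in> mirror \<Lambda>"
      using k unfolding mirror_def by blast
    moreover have "0\<^sub>v d = k + sign_change (vec d (\<lambda>_. -1)) k"
      using k assms(2) by (auto simp: sign_change_def intro!: eq_vecI)
    ultimately show ?thesis using k by (metis set_plus_intro)
  qed
  show "\<bar>h $ j\<bar> \<le> 2 * max_component \<Lambda>" if h: "h \<in> \<Lambda> + mirror \<Lambda>" and j: "j < d"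
  proof -
    obtain k k' \<sigma> where *: "k \<in> \<Lambda>" "k' \<in> \<Lambda>" "\<sigma> \<in> signs (dim_vec k')" "h = k + sign_change \<sigma> k'"
      using h by (auto simp: set_plus_def mirror_def)
    have dim: "dim_vec k = d" "dim_vec k' = d" using * assms(2) by auto
    have "h $ j = k $ j + \<sigma> $ j * k' $ j" using * dim j by (simp add: sign_change_def)
    moreover have "\<sigma> $ j = 1 \<or> \<sigma> $ j = -1" using *(3) dim j by (auto simp: signs_def)
    moreover have "\<bar>k $ j\<bar> \<le> max_component \<Lambda>" "\<bar>k' $ j\<bar> \<le> max_component \<Lambda>"
      using abs_le_max_component[OF assms(1)] * dim j by auto
    ultimately show ?thesis by auto
  qed
qed

theorem lemma15:
  fixes d n :: nat and \<Lambda> :: "int vec set"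
  assumes "1 \<le> d" and "1 \<le> n" and "finite \<Lambda>" and "\<Lambda> \<subseteq> nonneg_vecs d"
  shows "(\<forall>z \<in> carrier_vec d.
            (reconstructs d n z \<Lambda> \<longleftrightarrow>
               (\<forall>k \<in> \<Lambda>. \<forall>k' \<in> \<Lambda>. \<forall>\<sigma> \<in> signs_of k'. sign_change \<sigma> k' \<noteq> k \<longrightarrow>
                  \<not> [sign_change \<sigma> k' \<bullet> z = k \<bullet> z] (mod int n))) \<and>
            ((\<forall>k \<in> \<Lambda>. \<forall>k' \<in> \<Lambda>. \<forall>\<sigma> \<in> signs_of k'. sign_change \<sigma> k' \<noteq> k \<longrightarrow>
                  \<not> [sign_change \<sigma> k' \<bullet> z = k \<bullet> z] (mod int n)) \<longleftrightarrow>
               (\<forall>h \<in> (\<Lambda> + mirror \<Lambda>) - {0\<^sub>v d}. \<not> [h \<bullet> z = 0] (mod int n)))) \<and>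
         (prime n \<and> int n > max (int (card (\<Lambda> + mirror \<Lambda>))) (2 * max_component \<Lambda>) \<longrightarrow>
            cbc_constructible d n (\<Lambda> + mirror \<Lambda>) (zero_sections d (\<Lambda> + mirror \<Lambda>)) \<and>
            cbc_constructible d n (\<Lambda> + mirror \<Lambda>) (projections d (\<Lambda> + mirror \<Lambda>)) \<and>
            (\<exists>z \<in> gen_vecs n d. reconstructs d n z \<Lambda>))"
    (is "(\<forall>z \<in> carrier_vec d. (_ \<longleftrightarrow> ?alias z) \<and> (_ \<longleftrightarrow> ?sumset z)) \<and> (?large \<longrightarrow> ?cbc)")
proof (intro conjI ballI impI)
  let ?A = "\<Lambda> + mirror \<Lambda>"
  have carr: "\<Lambda> \<subseteq> carrier_vec d" using assms(4) by (auto simp: nonneg_vecs_def)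
  have R: "reconstructs d n z \<Lambda> \<longleftrightarrow> ?alias z" if z: "z \<in> carrier_vec d" for z
    unfolding reconstructs_iff_basis[OF assms(3,4) z assms(2)]
    using lattice_cos_coeff_eq_delta_iff[OF _ _ z assms(2)] assms(4) by (simp add: subset_iff)
  have S: "?alias z \<longleftrightarrow> ?sumset z" if z: "z \<in> carrier_vec d" for z
    by (rule aliasing_iff_sumset[OF carr z])
  show "reconstructs d n z \<Lambda> \<longleftrightarrow> ?alias z" "?alias z \<longleftrightarrow> ?sumset z" if "z \<in> carrier_vec d" for z
    using R[OF that] S[OF that] by blast+
  assume large: ?large
  hence "card ?A < n" "2 * max_component \<Lambda> < int n" "prime n" by auto
  note cbc = cbc_constructible_if_large_prime[OF \<open>prime n\<close> finite_sumset_mirror[OF assms(3) carr]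
      sumset_mirror_carrier[OF assms(3) carr] \<open>card ?A < n\<close> zero_in_sumset_mirror[OF assms(3) carr]
      le_less_trans[OF abs_sumset_mirror_le[OF assms(3) carr] \<open>2 * max_component \<Lambda> < int n\<close>]]
  show "cbc_constructible d n ?A (zero_sections d ?A)" "cbc_constructible d n ?A (projections d ?A)"
    by (rule cbc; assumption)+
  obtain z where z: "z \<in> gen_vecs n d" "nonvanishing_mod n ?A z"
    using cbc_constructible_generating_vector[OF \<open>cbc_constructible d n ?A (projections d ?A)\<close>]
    by (auto simp: projections_def)
  hence "z \<in> carrier_vec d" by (simp add: gen_vecs_def)
  moreover from this have "?sumset z" using z(2) by (auto simp: nonvanishing_mod_def)
  ultimately show "\<exists>z \<in> gen_vecs n d. reconstructs d n z \<Lambda>" using R S z(1) by blast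
qed

end
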